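(* Let $1\le k<n$ and let $M=\begin{pmatrix}A&B\\ C&D\end{pmatrix}\in\mathbb{H}^{n\times n}$ be written in block form with $A\in\mathbb{H}^{k\times k}$ and $D\in\mathbb{H}^{(n-k)\times(n-k)}$. If $A^{-1}$ exists, then $$\mathrm{Sdet}\left[\begin{pmatrix}A&B\\ C&D\end{pmatrix}\right]=\mathrm{Sdet}[A]\;\mathrm{Sdet}[D-CA^{-1}B].$$
   Context: $\mathbb{H}$ is the skew-field of real quaternions $q=a+ib+jc+kd$ with $a,b,c,d\in\mathbb{R}$, $i^2=j^2=k^2=ijk=-1$. For every $m\ge1$, every $N\in\mathbb{H}^{m\times m}$ is uniquely written $N=N_1+jN_2$ with $N_1,N_2\in\mathbb{C}^{m\times m}$ (where $\mathbb{C}=\mathbb{R}+i\mathbb{R}\subset\mathbb{H}$), and its complexification is the complex $2m\times 2m$ matrix $\mathcal{Z}[N]=\begin{pmatrix} N_1 & -N_2^*\\ N_2 & N_1^*\end{pmatrix}$, where $*$ is entrywise complex conjugation. The determinant $\det\mathcal{Z}[N]$ (the $q$-determinant) is real and nonnegative, and the Study determinant is normalized by $\mathrm{Sdet}[N]=\left(\det \mathcal{Z}[N]\right)^{1/2}\ge 0$. *)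

theory Defs
  imports Complex_Main "Jordan_Normal_Form.Determinant"
begin

section \<open>Real quaternions\<close>

datatype quat = Quat (qRe: real) (qI: real) (qJ: real) (qK: real)

lemma quat_eq_iff:
  "x = y \<longleftrightarrow> qRe x = qRe y \<and> qI x = qI y \<and> qJ x = qJ y \<and> qK x = qK y"
  by (cases x; cases y) auto

instantiation quat :: division_ring
begin

definition zero_quat :: quat where "0 = Quat 0 0 0 0"

definition one_quat :: quat where "1 = Quat 1 0 0 0"

definition plus_quat :: "quat \<Rightarrow> quat \<Rightarrow> quat" where
  "x + y = Quat (qRe x + qRe y) (qI x + qI y) (qJ x + qJ y) (qK x + qK y)"

definition uminus_quat :: "quat \<Rightarrow> quat" where
  "- x = Quat (- qRe x) (- qI x) (- qJ x) (- qK x)"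

definition minus_quat :: "quat \<Rightarrow> quat \<Rightarrow> quat" where
  "x - y = Quat (qRe x - qRe y) (qI x - qI y) (qJ x - qJ y) (qK x - qK y)"

definition times_quat :: "quat \<Rightarrow> quat \<Rightarrow> quat" where
  "x * y = Quat
     (qRe x * qRe y - qI x * qI y - qJ x * qJ y - qK x * qK y)
     (qRe x * qI y + qI x * qRe y + qJ x * qK y - qK x * qJ y)
     (qRe x * qJ y - qI x * qK y + qJ x * qRe y + qK x * qI y)
     (qRe x * qK y + qI x * qJ y - qJ x * qI y + qK x * qRe y)"

definition inverse_quat :: "quat \<Rightarrow> quat" where
  "inverse x = (let s = (qRe x)\<^sup>2 + (qI x)\<^sup>2 + (qJ x)\<^sup>2 + (qK x)\<^sup>2
     in Quat (qRe x / s) (- qI x / s) (- qJ x / s) (- qK x / s))"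

definition divide_quat :: "quat \<Rightarrow> quat \<Rightarrow> quat" where
  "x div y = x * inverse (y :: quat)"

instance
proof
  fix x y z :: quat
  note defs = quat_eq_iff zero_quat_def one_quat_def plus_quat_def uminus_quat_def
    minus_quat_def times_quat_def
  show "x + y + z = x + (y + z)" "x + y = y + x" "0 + x = x" "- x + x = 0" "x - y = x + - y"
    by (simp_all add: defs)
  show "x * y * z = x * (y * z)" "(x + y) * z = x * z + y * z" "x * (y + z) = x * y + x * z"
    by (simp_all add: defs algebra_simps)
  show "1 * x = x" "x * 1 = x" "(0::quat) \<noteq> 1"
    by (simp_all add: defs)
  show "x div y = x * inverse y" by (simp add: divide_quat_def)
  show "inverse (0::quat) = 0" by (simp add: defs inverse_quat_def)
  assume "x \<noteq> 0"
  define s where "s = (qRe x)\<^sup>2 + (qI x)\<^sup>2 + (qJ x)\<^sup>2 + (qK x)\<^sup>2"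
  have "s \<noteq> 0"
  proof
    assume "s = 0"
    hence "(qRe x)\<^sup>2 = 0 \<and> (qI x)\<^sup>2 = 0 \<and> (qJ x)\<^sup>2 = 0 \<and> (qK x)\<^sup>2 = 0"
      unfolding s_def
      using zero_le_power2[of "qRe x"] zero_le_power2[of "qI x"]
        zero_le_power2[of "qJ x"] zero_le_power2[of "qK x"]
      by linarith
    thus False using \<open>x \<noteq> 0\<close> by (simp add: defs)
  qed
  have inv: "inverse x = Quat (qRe x / s) (- qI x / s) (- qJ x / s) (- qK x / s)"
    by (simp add: inverse_quat_def s_def Let_def)
  have s1: "(qRe x * qRe x + qI x * qI x + qJ x * qJ x + qK x * qK x) / s = 1"
    using \<open>s \<noteq> 0\<close> by (simp add: s_def power2_eq_square)
  show "inverse x * x = 1" "x * inverse x = 1"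
    using s1 by (simp_all add: inv defs add_divide_distrib algebra_simps)
qed

end

definition quat_i :: quat where "quat_i = Quat 0 1 0 0"
definition quat_j :: quat where "quat_j = Quat 0 0 1 0"
definition quat_k :: quat where "quat_k = Quat 0 0 0 1"

lemma quat_units:
  "quat_i * quat_i = -1" "quat_j * quat_j = -1" "quat_k * quat_k = -1"
  "quat_i * quat_j * quat_k = -1"
  by (simp_all add: quat_i_def quat_j_def quat_k_def times_quat_def uminus_quat_def one_quat_def)

definition quat_of_complex :: "complex \<Rightarrow> quat" where
  "quat_of_complex z = Quat (Re z) (Im z) 0 0"


section \<open>Complexification and Study determinant\<close>

text \<open>The complex components of \<open>q = z + j w\<close>. Since \<open>j i = - k\<close>, the \<open>k\<close>-coordinate of
  \<open>q\<close> enters \<open>w\<close> with a minus sign.\<close>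

definition quat_c1 :: "quat \<Rightarrow> complex" where
  "quat_c1 q = Complex (qRe q) (qI q)"

definition quat_c2 :: "quat \<Rightarrow> complex" where
  "quat_c2 q = Complex (qJ q) (- qK q)"

lemma quat_decomp_iff:
  "q = quat_of_complex z + quat_j * quat_of_complex w \<longleftrightarrow> z = quat_c1 q \<and> w = quat_c2 q"
  by (auto simp: quat_eq_iff quat_of_complex_def quat_j_def plus_quat_def times_quat_def
      quat_c1_def quat_c2_def complex_eq_iff)

lemma quat_mat_decomp_iff:
  assumes "N \<in> carrier_mat m m" "N1 \<in> carrier_mat m m" "N2 \<in> carrier_mat m m"
  shows "N = map_mat quat_of_complex N1 + quat_j \<cdot>\<^sub>m map_mat quat_of_complex N2
    \<longleftrightarrow> N1 = map_mat quat_c1 N \<and> N2 = map_mat quat_c2 N"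
  using assms by (auto simp: mat_eq_iff quat_decomp_iff)

definition complexification :: "quat mat \<Rightarrow> complex mat" where
  "complexification N =
     four_block_mat (map_mat quat_c1 N) (- map_mat cnj (map_mat quat_c2 N))
                    (map_mat quat_c2 N) (map_mat cnj (map_mat quat_c1 N))"

lemma det_complexification_real:
  assumes N: "N \<in> carrier_mat m m"
  shows "det (complexification N) \<in> \<real>"
proof -
  let ?Z = "complexification N"
  let ?J = "four_block_mat (0\<^sub>m m m) (- 1\<^sub>m m) (1\<^sub>m m) (0\<^sub>m m m) :: complex mat"
  let ?J' = "four_block_mat (0\<^sub>m m m) (1\<^sub>m m) (- 1\<^sub>m m) (0\<^sub>m m m) :: complex mat"
  define P where "P = map_mat quat_c1 N"
  define Q where "Q = map_mat quat_c2 N"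
  define P' where "P' = map_mat cnj P"
  define Q' where "Q' = map_mat cnj Q"
  have c: "P \<in> carrier_mat m m" "Q \<in> carrier_mat m m" "P' \<in> carrier_mat m m"
    "Q' \<in> carrier_mat m m"
    using N by (simp_all add: P_def Q_def P'_def Q'_def)
  have cc: "map_mat cnj P' = P" "map_mat cnj (- Q') = - Q"
    by (auto simp: P'_def Q'_def intro!: eq_matI)
  have Z: "?Z = four_block_mat P (- Q') Q P'"
    by (simp add: complexification_def P_def Q_def P'_def Q'_def)
  have Zc: "?Z \<in> carrier_mat (m + m) (m + m)" using c by (simp add: Z)
  have cZ: "map_mat cnj ?Z = four_block_mat P' (- Q) Q' P"
    unfolding Z using c cc
    by (subst map_four_block_mat[of _ m m _ m _ m]) (simp_all add: P'_def[symmetric] Q'_def[symmetric])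
  have neg: "(- 1\<^sub>m m) * X = - X" "X * (- 1\<^sub>m m) = - X" "- 0\<^sub>m m m + X = X" if "X \<in> carrier_mat m m"
    for X :: "complex mat"
    using that by auto
  have JZ: "?J * ?Z = map_mat cnj ?Z * ?J"
    unfolding Z cZ[unfolded Z] using c
    by (subst (1 2) mult_four_block_mat[of _ m m _ m _ m _ _ m _ m]) (simp_all add: neg)
  have JJ: "?J * ?J' = 1\<^sub>m (m + m)"
  proof -
    have "?J * ?J' = four_block_mat (1\<^sub>m m) (0\<^sub>m m m) (- 0\<^sub>m m m) (1\<^sub>m m)"
      by (subst mult_four_block_mat[of _ m m _ m _ m _ _ m _ m]) (simp_all add: neg)
    also have "- 0\<^sub>m m m = (0\<^sub>m m m :: complex mat)" by auto
    finally show ?thesis by simp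
  qed
  have Jc: "?J \<in> carrier_mat (m + m) (m + m)" "?J' \<in> carrier_mat (m + m) (m + m)" by simp_all
  have "det ?J * det ?J' = 1" using det_mult[OF Jc] by (simp add: JJ)
  hence J0: "det ?J \<noteq> 0" by auto
  interpret cnj: comm_ring_hom cnj by unfold_locales auto
  have cZc: "map_mat cnj ?Z \<in> carrier_mat (m + m) (m + m)" using Zc by simp
  have "det ?J * det ?Z = det (map_mat cnj ?Z) * det ?J"
    by (simp only: det_mult[OF Jc(1) Zc, symmetric] det_mult[OF cZc Jc(1), symmetric] JZ)
  hence "cnj (det ?Z) = det ?Z" using J0 by auto
  thus ?thesis by (simp add: Reals_cnj_iff)
qed

text \<open>For square \<open>N\<close> the determinant of the complexification is real (see above) and
  nonnegative, so \<open>Re\<close> only adjusts the type.\<close>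

definition Sdet :: "quat mat \<Rightarrow> real" where
  "Sdet N = sqrt (Re (det (complexification N)))"


section \<open>Inverse of a matrix over a possibly noncommutative ring\<close>

text \<open>Only meaningful when \<open>invertible_mat A\<close> holds.\<close>

definition mat_inv :: "'a :: semiring_1 mat \<Rightarrow> 'a mat" where
  "mat_inv A = (THE B. inverts_mat A B \<and> inverts_mat B A)"

lemma mat_inv_unique:
  fixes A :: "'a :: semiring_1 mat"
  assumes A: "A \<in> carrier_mat m m"
    and B: "inverts_mat A B" "inverts_mat B A" and C: "inverts_mat A C" "inverts_mat C A"
  shows "B = C"
proof -
  have car: "X \<in> carrier_mat m m" if "inverts_mat A X" "inverts_mat X A" for X
  proof -
    have "dim_col (A * X) = m" "dim_col (X * A) = dim_row X"
      using that A unfolding inverts_mat_def by auto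
    thus ?thesis using A by auto
  qed
  note cB = car[OF B] and cC = car[OF C]
  have "B = B * (A * C)" using C(1) A cB by (simp add: inverts_mat_def)
  also have "\<dots> = (B * A) * C" using assoc_mult_mat[OF cB A cC] by simp
  also have "\<dots> = C" using B(2) cB cC by (simp add: inverts_mat_def)
  finally show ?thesis .
qed

lemma mat_inv_eqI:
  fixes A :: "'a :: semiring_1 mat"
  assumes "A \<in> carrier_mat m m" "inverts_mat A B" "inverts_mat B A"
  shows "mat_inv A = B"
  unfolding mat_inv_def using assms mat_inv_unique[OF assms(1)] by blast

lemma mat_inv_inverts:
  fixes A :: "'a :: semiring_1 mat"
  assumes "invertible_mat A"
  shows "inverts_mat A (mat_inv A)" "inverts_mat (mat_inv A) A"
proof -
  from assms obtain B where B: "inverts_mat A B" "inverts_mat B A"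
    and sq: "square_mat A" by (auto simp: invertible_mat_def)
  have "A \<in> carrier_mat (dim_row A) (dim_row A)" using sq by auto
  from mat_inv_eqI[OF this B] B
  show "inverts_mat A (mat_inv A)" "inverts_mat (mat_inv A) A" by simp_all
qed

end

(*
  The map Z is multiplicative, also on rectangular matrices, and up to a simultaneous permutation
  of rows and columns the matrix Z[M] consists of the blocks Z[A], Z[B], Z[C], Z[D]. The claim is
  therefore the Schur complement formula for complex matrices, taken at Z[A], with
  Z[A^-1] as the inverse of Z[A]. Since the q-determinants are real, taking Re respects the product.
*)

theory Submission
  imports Defs
begin

text \<open>The product rule here, and the one for \<open>quat_c2\<close>, come from expanding
  \<open>(z + j w) (z' + j w')\<close> with \<open>z j = j (cnj z)\<close> and
  \<open>j j = -1\<close>.\<close>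

lemma quat_c1_simps:
  "quat_c1 0 = 0" "quat_c1 1 = 1" "quat_c1 (x + y) = quat_c1 x + quat_c1 y"
  "quat_c1 (x - y) = quat_c1 x - quat_c1 y"
  "quat_c1 (x * y) = quat_c1 x * quat_c1 y - cnj (quat_c2 x) * quat_c2 y"
  by (simp_all add: quat_c1_def quat_c2_def complex_eq_iff zero_quat_def one_quat_def
      plus_quat_def minus_quat_def times_quat_def)

lemma quat_c2_simps:
  "quat_c2 0 = 0" "quat_c2 1 = 0" "quat_c2 (x + y) = quat_c2 x + quat_c2 y"
  "quat_c2 (x - y) = quat_c2 x - quat_c2 y"
  "quat_c2 (x * y) = quat_c2 x * quat_c1 y + cnj (quat_c1 x) * quat_c2 y"
  by (simp_all add: quat_c1_def quat_c2_def complex_eq_iff zero_quat_def one_quat_def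
      plus_quat_def minus_quat_def times_quat_def)

lemma quat_c1_sum: "quat_c1 (sum f S) = (\<Sum>x\<in>S. quat_c1 (f x))"
  by (induction S rule: infinite_finite_induct) (simp_all add: quat_c1_simps)

lemma quat_c2_sum: "quat_c2 (sum f S) = (\<Sum>x\<in>S. quat_c2 (f x))"
  by (induction S rule: infinite_finite_induct) (simp_all add: quat_c2_simps)

lemma complexification_carrier:
  "N \<in> carrier_mat r c \<Longrightarrow> complexification N \<in> carrier_mat (r + r) (c + c)"
  by (simp add: complexification_def)

lemma complexification_one: "complexification (1\<^sub>m m) = 1\<^sub>m (m + m)"
  by (rule eq_matI) (auto simp: complexification_def quat_c1_simps quat_c2_simps)

lemma complexification_minus:
  assumes "X \<in> carrier_mat r c" "Y \<in> carrier_mat r c"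
  shows "complexification (X - Y) = complexification X - complexification Y"
  using assms
  by (intro eq_matI) (auto simp: complexification_def quat_c1_simps quat_c2_simps)

lemma complexification_mult:
  assumes X: "X \<in> carrier_mat r s" and Y: "Y \<in> carrier_mat s c"
  shows "complexification (X * Y) = complexification X * complexification Y"
proof -
  define X1 X2 Y1 Y2 where "X1 = map_mat quat_c1 X" and "X2 = map_mat quat_c2 X"
    and "Y1 = map_mat quat_c1 Y" and "Y2 = map_mat quat_c2 Y"
  have car: "X1 \<in> carrier_mat r s" "X2 \<in> carrier_mat r s"
    "Y1 \<in> carrier_mat s c" "Y2 \<in> carrier_mat s c"
    using X Y by (simp_all add: X1_def X2_def Y1_def Y2_def)
  have "complexification X * complexification Y =
    four_block_mat (X1 * Y1 + - map_mat cnj X2 * Y2) (X1 * - map_mat cnj Y2 + - map_mat cnj X2 * map_mat cnj Y1)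
      (X2 * Y1 + map_mat cnj X1 * Y2) (X2 * - map_mat cnj Y2 + map_mat cnj X1 * map_mat cnj Y1)"
    unfolding complexification_def X1_def[symmetric] X2_def[symmetric] Y1_def[symmetric] Y2_def[symmetric]
    using car by (intro mult_four_block_mat) auto
  \<comment> \<open>Compared block by block and entry by entry: each entry of \<open>X * Y\<close>
    is a sum of quaternion products, split by the two product rules; the right-hand blocks are their
    conjugates.\<close>
  also have "\<dots> = complexification (X * Y)"
    unfolding complexification_def
    using X Y
    by (intro cong_four_block_mat)
      (auto intro!: eq_matI simp: X1_def X2_def Y1_def Y2_def scalar_prod_def quat_c1_sum
        quat_c2_sum quat_c1_simps quat_c2_simps sum.distrib sum_subtractf sum_negf)
  finally show ?thesis ..
qed

text \<open>Block LU factorization: \<open>?L\<close> is unit lower triangular, \<open>?U\<close> is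
  upper triangular with the Schur complement as its last diagonal block, and both determinants can
  be read off.\<close>

lemma det_schur_complement:
  fixes A :: "'a :: idom mat"
  assumes A: "A \<in> carrier_mat p p" and B: "B \<in> carrier_mat p q"
    and C: "C \<in> carrier_mat q p" and D: "D \<in> carrier_mat q q"
    and A': "A' \<in> carrier_mat p p" and inv: "A' * A = 1\<^sub>m p"
  shows "det (four_block_mat A B C D) = det A * det (D - C * A' * B)"
proof -
  let ?L = "four_block_mat (1\<^sub>m p) (0\<^sub>m p q) (C * A') (1\<^sub>m q)"
  let ?U = "four_block_mat A B (0\<^sub>m q p) (D - C * A' * B)"
  have CA: "C * A' \<in> carrier_mat q p" and CAB: "C * A' * B \<in> carrier_mat q q"
    using A' B C by auto
  have S: "D - C * A' * B \<in> carrier_mat q q"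
    by (rule minus_carrier_mat[OF CAB])
  \<comment> \<open>This is the lower left block of \<open>?L * ?U\<close>; the cancellation after
    it settles the lower right one, \<open>C * A' * B + (D - C * A' * B)\<close>.\<close>
  have "C * A' * A = C"
    using assoc_mult_mat[OF C A' A] C by (simp add: inv)
  moreover have "X + (D - X) = D" if "X \<in> carrier_mat q q" for X
    using that D by (intro eq_matI) auto
  ultimately have "?L * ?U = four_block_mat A B C D"
    using A B C D CA CAB
    by (subst mult_four_block_mat[of _ p p _ q _ q _ _ p _ q]) (simp_all add: S)
  moreover have "?L \<in> carrier_mat (p + q) (p + q)" "?U \<in> carrier_mat (p + q) (p + q)"
    using A S by auto
  ultimately have "det (four_block_mat A B C D) = det ?L * det ?U"
    by (metis det_mult)
  also have "det ?L = 1"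
    using CA by (subst det_four_block_mat_upper_right_zero[of _ p _ q]) auto
  also have "det ?U = det A * det (D - C * A' * B)"
    using A B S by (intro det_four_block_mat_lower_left_zero) auto
  finally show ?thesis by simp
qed

text \<open>Rows and, through the transpose, columns each contribute one factor
  \<open>signof p\<close>, and its square is 1.\<close>

lemma det_permute_rows_cols:
  fixes A :: "'a :: comm_ring_1 mat"
  assumes A: "A \<in> carrier_mat n n" and p: "p permutes {0..<n}"
  shows "det (mat n n (\<lambda>(i, j). A $$ (p i, p j))) = det A"
proof -
  let ?R = "mat n n (\<lambda>(i, j). A $$ (p i, j))"
  let ?S = "mat n n (\<lambda>(i, j). ?R\<^sup>T $$ (p i, j))"
  have p_less: "p i < n" if "i < n" for i
    using permutes_in_image[OF p, of i] that by simp
  have "mat n n (\<lambda>(i, j). A $$ (p i, p j)) = ?S\<^sup>T"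
    by (rule eq_matI) (auto simp: p_less)
  then have "det (mat n n (\<lambda>(i, j). A $$ (p i, p j))) = det ?S"
    by (simp add: det_transpose[of _ n])
  also have "\<dots> = signof p * det ?R\<^sup>T"
    by (rule det_permute_rows[OF _ p]) simp
  also have "det ?R\<^sup>T = signof p * det A"
    by (simp add: det_transpose[of _ n] det_permute_rows[OF A p])
  also have "signof p * (signof p * det A) = det A"
    by (simp add: sign_def)
  finally show ?thesis .
qed

text \<open>The complexification of a block matrix lists its rows and columns in sections of lengths
  \<open>p, q, p, q\<close>; composing with this permutation brings them into the order \<open>p, p, q, q\<close>, in
  which the complexifications of the individual blocks are contiguous.\<close>

definition swap_middle :: "nat \<Rightarrow> nat \<Rightarrow> nat \<Rightarrow> nat" where
  "swap_middle p q i =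
     (if i < p then i else if i < p + p then i + q
      else if i < p + p + q then i - p else i)"

text \<open>The right-hand sides are grouped so that \<open>p + q\<close> marks the start of the
  second half, the shape that \<open>index_complexification\<close> expects for a matrix of size
  \<open>p + q\<close>.\<close>

lemma swap_middle_simps:
  "i < p \<Longrightarrow> swap_middle p q i = i"
  "i < p \<Longrightarrow> swap_middle p q (p + i) = p + q + i"
  "i < q \<Longrightarrow> swap_middle p q (p + p + i) = p + i"
  "swap_middle p q (p + p + q + i) = p + q + (p + i)"
  by (simp_all add: swap_middle_def)

text \<open>Turns an index into a section start plus an offset, so that the rules for
  \<open>swap_middle\<close> apply.\<close>

lemma four_sections_cases:
  fixes i p q :: nat
  assumes "i < p + p + q + q"
  obtains (1) "i < p" | (2) i' where "i = p + i'" "i' < p"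
    | (3) i' where "i = p + p + i'" "i' < q" | (4) i' where "i = p + p + q + i'" "i' < q"
proof -
  consider "i < p" | "p \<le> i" "i < p + p" | "p + p \<le> i" "i < p + p + q" | "p + p + q \<le> i"
    by linarith
  then show thesis
  proof cases
    case 1
    then show thesis by (rule that(1))
  next
    case 2
    then show thesis using that(2)[of "i - p"] by simp
  next
    case 3
    then show thesis using that(3)[of "i - (p + p)"] by simp
  next
    case 4
    then show thesis using that(4)[of "i - (p + p + q)"] assms by simp
  qed
qed

lemma swap_middle_permutes: "swap_middle p q permutes {0..<p + p + q + q}"
proof (rule inj_imp_permutes)
  \<comment> \<open>\<open>?g\<close> exchanges the two middle sections back. An injective self-map
    of a finite set that fixes everything outside it is a permutation.\<close>
  let ?g = "\<lambda>i. if i < p then i else if i < p + q then i + p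
    else if i < p + q + p then i - q else i"
  have inv: "?g (swap_middle p q i) = i" if "i < p + p + q + q" for i
    using that by (cases rule: four_sections_cases; simp add: swap_middle_simps)
  show "inj_on (swap_middle p q) {0..<p + p + q + q}"
    by (rule inj_on_inverseI[where g = ?g], rule inv) simp
  show "swap_middle p q i \<in> {0..<p + p + q + q}" if "i \<in> {0..<p + p + q + q}" for i
    using that by (auto simp: swap_middle_def)
qed (auto simp: swap_middle_def)

lemma index_complexification:
  assumes "N \<in> carrier_mat r c" and "i < r" and "j < c"
  shows "complexification N $$ (i, j) = quat_c1 (N $$ (i, j))"
    and "complexification N $$ (i, c + j) = - cnj (quat_c2 (N $$ (i, j)))"
    and "complexification N $$ (r + i, j) = quat_c2 (N $$ (i, j))"
    and "complexification N $$ (r + i, c + j) = cnj (quat_c1 (N $$ (i, j)))"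
  using assms by (auto simp: complexification_def)

lemma det_complexification_four_block:
  assumes A: "A \<in> carrier_mat p p" and B: "B \<in> carrier_mat p q"
    and C: "C \<in> carrier_mat q p" and D: "D \<in> carrier_mat q q"
  shows "det (complexification (four_block_mat A B C D)) =
    det (four_block_mat (complexification A) (complexification B)
      (complexification C) (complexification D))"
proof -
  let ?Z = "complexification (four_block_mat A B C D)"
  let ?n = "p + p + q + q"
  have Z: "?Z \<in> carrier_mat ?n ?n"
    using complexification_carrier[OF four_block_carrier_mat[OF A D]] by (simp add: ac_simps)
  have "four_block_mat (complexification A) (complexification B)
      (complexification C) (complexification D) =
    mat ?n ?n (\<lambda>(i, j). ?Z $$ (swap_middle p q i, swap_middle p q j))" (is "?F = ?G")
  proof (rule eq_matI)
    fix i j assume "i < dim_row ?G" "j < dim_col ?G"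
    then have ij: "i < ?n" "j < ?n" by simp_all
    note idx = index_complexification[OF A] index_complexification[OF B]
      index_complexification[OF C] index_complexification[OF D]
      index_complexification[OF four_block_carrier_mat[OF A D]]
    note dims = carrier_matD[OF A] carrier_matD[OF B] carrier_matD[OF C] carrier_matD[OF D]
      carrier_matD[OF complexification_carrier[OF A]] carrier_matD[OF complexification_carrier[OF D]]
    \<comment> \<open>Four row sections against four column sections: in each of the sixteen cases
      both sides become the same component, up to sign and conjugation, of one entry of
      \<open>A\<close>, \<open>B\<close>, \<open>C\<close> or \<open>D\<close>.\<close>
    from ij(1) show "?F $$ (i, j) = ?G $$ (i, j)"
      by (cases rule: four_sections_cases)
        (use ij(2) in \<open>cases rule: four_sections_cases;
           simp add: swap_middle_simps idx dims\<close>)+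
  qed (use A D in \<open>simp_all add: complexification_def\<close>)
  then show ?thesis
    using det_permute_rows_cols[OF Z swap_middle_permutes] by simp
qed

theorem corollary8p1:
  fixes A B C D M :: "quat mat" and k n :: nat
  assumes "1 \<le> k" and "k < n"
    and "A \<in> carrier_mat k k"
    and "B \<in> carrier_mat k (n - k)"
    and "C \<in> carrier_mat (n - k) k"
    and "D \<in> carrier_mat (n - k) (n - k)"
    and "M = four_block_mat A B C D"
    and "invertible_mat A"
  shows "Sdet M = Sdet A * Sdet (D - C * mat_inv A * B)"
proof -
  note A = assms(3) and B = assms(4) and C = assms(5) and D = assms(6)
  note cc = complexification_carrier
  let ?m = "n - k" and ?S = "D - C * mat_inv A * B"
  have AA': "A * mat_inv A = 1\<^sub>m k" and A'A: "mat_inv A * A = 1\<^sub>m (dim_row (mat_inv A))"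
    using mat_inv_inverts[OF assms(8)] A by (simp_all add: inverts_mat_def)
  \<comment> \<open>\<open>inverts_mat\<close> sizes its identity by the rows of the first factor,
    so the shape of \<open>mat_inv A\<close> follows from counting columns in both
    equations.\<close>
  have "dim_row (mat_inv A) = k"
    using arg_cong[OF A'A, of dim_col] A by simp
  moreover have "dim_col (mat_inv A) = k"
    using arg_cong[OF AA', of dim_col] by simp
  ultimately have A': "mat_inv A \<in> carrier_mat k k" and inv: "mat_inv A * A = 1\<^sub>m k"
    using A'A by auto
  have CA': "C * mat_inv A \<in> carrier_mat ?m k" and CA'B: "C * mat_inv A * B \<in> carrier_mat ?m ?m"
    using A' B C by auto
  have S: "?S \<in> carrier_mat ?m ?m"
    by (rule minus_carrier_mat[OF CA'B])
  have "complexification (mat_inv A) * complexification A = 1\<^sub>m (k + k)"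
    by (simp add: complexification_mult[OF A' A, symmetric] inv complexification_one)
  then have "det (complexification M) = det (complexification A) *
    det (complexification D - complexification C * complexification (mat_inv A) * complexification B)"
    unfolding assms(7) det_complexification_four_block[OF A B C D]
    by (rule det_schur_complement[OF cc[OF A] cc[OF B] cc[OF C] cc[OF D] cc[OF A']])
  also have "complexification D - complexification C * complexification (mat_inv A) * complexification B
    = complexification ?S"
    by (simp add: complexification_minus[OF D CA'B] complexification_mult[OF CA' B]
        complexification_mult[OF C A'])
  finally have "Re (det (complexification M)) =
    Re (det (complexification A)) * Re (det (complexification ?S))"
    using det_complexification_real[OF A] det_complexification_real[OF S]
    by (auto elim!: Reals_cases)
  \<comment> \<open>\<open>sqrt\<close> extends to negative reals as an odd function and is
    multiplicative on all reals.\<close>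
  then show ?thesis
    by (simp add: Sdet_def real_sqrt_mult)
qed

end
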